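(* Let $d\ge 1$ and let $H$ be an induced subgraph of the $d$-dimensional grid graph $P_{n_1}\square\cdots\square P_{n_d}$. If $F$ is a nonempty $\ell$-leaky fort of $H$ with $\ell\le 2d-1$, then $F$ contains a vertex $v$ with $\deg_H(v)\le 2d-1$; that is, $F\cap \delta H\neq\emptyset$.
   Context: All graphs are finite, simple and undirected. $N_G(v)$ denotes the open neighborhood of $v$ in $G$ and $\deg_G(v)=|N_G(v)|$. $P_n$ is the path on $n$ vertices, and the $d$-dimensional grid graph $P_{n_1}\square\cdots\square P_{n_d}$ is the Cartesian product: its vertices are the tuples in $V(P_{n_1})\times\cdots\times V(P_{n_d})$, and two tuples are adjacent iff they differ in exactly one coordinate $k$ and their $k$-th coordinates are adjacent in $P_{n_k}$. For an integer $\ell\ge 0$, an $\ell$-leaky fort in a graph $G$ is a subset $S\subseteq V(G)$ such that $$\left|\{x\in V(G)\setminus S:\ |N_G(x)\cap S|=1\}\right|\le \ell.$$ For an induced subgraph $H$ of a $d$-dimensional grid graph, the boundary of $H$ is $\delta H=\{v\in V(H):\deg_H(v)\le 2d-1\}$. *)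

theory Defs
  imports
    "Graph_Theory.Pair_Digraph"
    "Graph_Theory.Digraph_Component"
    "HOL-Library.FuncSet"
begin

text \<open>
  A finite simple undirected graph is a \<^typ>\<open>'a pair_pre_digraph\<close> satisfying
  \<^locale>\<open>pair_graph\<close>: each edge \<open>{u, v}\<close> is represented by the two arcs \<open>(u, v)\<close> and \<open>(v, u)\<close>.
\<close>

definition neighborhood :: "'a pair_pre_digraph \<Rightarrow> 'a \<Rightarrow> 'a set" where
  "neighborhood G v = {u \<in> pverts G. (v, u) \<in> parcs G}"

definition degree :: "'a pair_pre_digraph \<Rightarrow> 'a \<Rightarrow> nat" where
  "degree G v = card (neighborhood G v)"

definition path_graph :: "nat \<Rightarrow> nat pair_pre_digraph" where
  "path_graph n = \<lparr>pverts = {..<n}, parcs = {(i, j). i < n \<and> j < n \<and> (j = Suc i \<or> i = Suc j)}\<rparr>"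

text \<open>
  Tuples indexed by \<open>I\<close> are extensional functions, so that distinct vertices
  differ at a coordinate in \<open>I\<close>.
\<close>

definition cartesian_product ::
    "'i set \<Rightarrow> ('i \<Rightarrow> 'a pair_pre_digraph) \<Rightarrow> ('i \<Rightarrow> 'a) pair_pre_digraph" where
  "cartesian_product I G =
    \<lparr>pverts = (\<Pi>\<^sub>E k\<in>I. pverts (G k)),
     parcs = {(x, y). x \<in> (\<Pi>\<^sub>E k\<in>I. pverts (G k)) \<and> y \<in> (\<Pi>\<^sub>E k\<in>I. pverts (G k)) \<and>
       (\<exists>k. {j \<in> I. x j \<noteq> y j} = {k} \<and> (x k, y k) \<in> parcs (G k))}\<rparr>"

text \<open>
  The coordinates are numbered from 0, so \<open>n k\<close> is the number of vertices of the path
  in coordinate \<open>k < d\<close>.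
\<close>

definition grid_graph :: "nat \<Rightarrow> (nat \<Rightarrow> nat) \<Rightarrow> (nat \<Rightarrow> nat) pair_pre_digraph" where
  "grid_graph d n = cartesian_product {..<d} (\<lambda>k. path_graph (n k))"

text \<open>Meaningful for finite graphs only, since \<^const>\<open>card\<close> is 0 on infinite sets.\<close>

definition leaky_fort :: "nat \<Rightarrow> 'a pair_pre_digraph \<Rightarrow> 'a set \<Rightarrow> bool" where
  "leaky_fort l G S \<longleftrightarrow>
    S \<subseteq> pverts G \<and> card {x \<in> pverts G - S. card (neighborhood G x \<inter> S) = 1} \<le> l"

text \<open>The truncated subtraction \<open>2 * d - 1\<close> is the intended number only for \<open>d \<ge> 1\<close>.\<close>

definition boundary :: "nat \<Rightarrow> 'a pair_pre_digraph \<Rightarrow> 'a set" where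
  "boundary d H = {v \<in> pverts H. degree H v \<le> 2 * d - 1}"

lemma pair_graph_grid_graph: "pair_graph (grid_graph d n)"
proof -
  let ?G = "grid_graph d n"
  have fin: "finite (pverts ?G)"
    by (auto simp: grid_graph_def cartesian_product_def path_graph_def intro!: finite_PiE)
  have sub: "parcs ?G \<subseteq> pverts ?G \<times> pverts ?G"
    by (auto simp: grid_graph_def cartesian_product_def)
  have sym_arcs: "(y, x) \<in> parcs ?G" if "(x, y) \<in> parcs ?G" for x y
  proof -
    have "{j \<in> {..<d}. y j \<noteq> x j} = {j \<in> {..<d}. x j \<noteq> y j}" by auto
    with that show ?thesis
      by (auto simp: grid_graph_def cartesian_product_def path_graph_def)
  qed
  have irrefl: "x \<noteq> y" if "(x, y) \<in> parcs ?G" for x y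
    using that by (auto simp: grid_graph_def cartesian_product_def)
  show ?thesis
  proof unfold_locales
    show "finite (parcs ?G)"
      using fin sub finite_subset by blast
    show "symmetric ?G"
      by (auto simp: symmetric_def intro!: symI sym_arcs)
  qed (use fin sub irrefl in auto)
qed

lemma pair_graph_induced_subgraph:
  assumes "pair_graph G" "induced_subgraph (with_proj H) (with_proj G)"
  shows "pair_graph H"
proof -
  interpret G: pair_graph G by fact
  interpret H: digraph "with_proj H"
    using assms(2) by (rule G.digraphI_induced)
  interpret H: sym_digraph "with_proj H"
    using assms(2) by (rule G.induced_graph_imp_graph)
  have "graph (with_proj H)"
    by unfold_locales (rule H.sym_arcs)
  then show ?thesis by (rule pair_graphI_graph)
qed

end

theory Submission
  imports Defs
begin

text \<open>
  Suppose every vertex of \<open>F\<close> has all its \<open>2d\<close> grid neighbours in \<open>H\<close>. For each of the \<open>2d\<close>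
  signed directions take a vertex \<open>v\<close> of \<open>F\<close> that is extreme in that direction. Its neighbour
  \<open>x\<close> in that direction lies in \<open>H\<close>, outside \<open>F\<close>, and by extremality \<open>v\<close> is the only neighbour of
  \<open>x\<close> in \<open>F\<close>. As \<open>x\<close> determines \<open>v\<close> and hence the direction, these are \<open>2d\<close> distinct leaks.
\<close>

text \<open>At \<open>v k = 0\<close> the truncated subtraction makes the downward step return \<open>v\<close> itself.\<close>

definition step :: "(nat \<Rightarrow> nat) \<Rightarrow> nat \<times> bool \<Rightarrow> nat \<Rightarrow> nat" where
  "step v = (\<lambda>(k, up). v(k := if up then Suc (v k) else v k - 1))"

lemma grid_arc_step:
  assumes "(x, y) \<in> parcs (grid_graph d n)"
  shows "y \<in> step x ` ({..<d} \<times> UNIV)"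
proof -
  have "x \<in> (\<Pi>\<^sub>E k\<in>{..<d}. {..<n k}) \<and> y \<in> (\<Pi>\<^sub>E k\<in>{..<d}. {..<n k}) \<and>
      (\<exists>k. {j \<in> {..<d}. x j \<noteq> y j} = {k} \<and> (x k, y k) \<in> parcs (path_graph (n k)))"
    using assms unfolding grid_graph_def cartesian_product_def
    by (simp only: pair_pre_digraph.simps mem_Collect_eq case_prod_conv)
      (simp only: path_graph_def pair_pre_digraph.simps)
  then obtain k where
    x: "x \<in> (\<Pi>\<^sub>E k\<in>{..<d}. {..<n k})" and y: "y \<in> (\<Pi>\<^sub>E k\<in>{..<d}. {..<n k})"
    and k: "{j \<in> {..<d}. x j \<noteq> y j} = {k}" and "(x k, y k) \<in> parcs (path_graph (n k))"
    by (elim conjE exE)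
  from this(4) have adj: "y k = Suc (x k) \<or> x k = Suc (y k)"
    by (simp add: path_graph_def)
  have k_iff: "j \<in> {j \<in> {..<d}. x j \<noteq> y j} \<longleftrightarrow> j = k" for j
    unfolding k by (rule singleton_iff)
  \<comment> \<open>The arc constrains only coordinates below \<open>d\<close>; beyond them both
    tuples are extensional and take the same default value.\<close>
  have eq: "y j = x j" if "j \<noteq> k" for j
  proof (cases "j < d")
    case True
    with k_iff[of j] that show ?thesis by simp
  next
    case False
    then show ?thesis using PiE_arb[OF x, of j] PiE_arb[OF y, of j] by simp
  qed
  \<comment> \<open>If the flag is false, then \<open>x k = Suc (y k)\<close>, so the truncated
    subtraction in \<open>step\<close> is exact.\<close>
  have "y = step x (k, y k = Suc (x k))"
    using eq adj by (auto simp: step_def fun_eq_iff)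
  moreover have "k < d"
    using k_iff[of k] by simp
  ultimately show ?thesis by auto
qed

lemma neighborhood_step:
  assumes "parcs H \<subseteq> parcs (grid_graph d n)"
  shows "neighborhood H v \<subseteq> step v ` ({..<d} \<times> UNIV)"
  using assms grid_arc_step by (auto simp: neighborhood_def)

text \<open>Pigeonhole: there are only 2d signed directions, so 2d neighbours leave no room for a
  missing step or for two directions with the same endpoint.\<close>

lemma full_degree:
  assumes "parcs H \<subseteq> parcs (grid_graph d n)" and "2 * d \<le> degree H v"
  shows "neighborhood H v = step v ` ({..<d} \<times> UNIV)"
    and "inj_on (step v) ({..<d} \<times> UNIV)"
proof -
  let ?D = "{..<d} \<times> (UNIV :: bool set)"
  have fin: "finite ?D" and card: "card ?D = 2 * d"
    by (simp_all add: card_cartesian_product)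
  have sub: "neighborhood H v \<subseteq> step v ` ?D"
    using assms(1) by (rule neighborhood_step)
  have le: "card (step v ` ?D) \<le> card (neighborhood H v)"
    using card_image_le[OF fin, of "step v"] card assms(2) by (simp add: degree_def)
  show "neighborhood H v = step v ` ?D"
    by (rule card_seteq[OF _ sub le]) (use fin in blast)
  then have "card (step v ` ?D) = card ?D"
    using card_image_le[OF fin, of "step v"] card assms(2) by (simp add: degree_def)
  with fin show "inj_on (step v) ?D"
    by (rule eq_card_imp_inj_on)
qed

lemma extreme_vertex:
  fixes F :: "(nat \<Rightarrow> nat) set"
  assumes "finite F" "F \<noteq> {}"
  obtains v where "v \<in> F" "\<And>u. u \<in> F \<Longrightarrow> if up then u k \<le> v k else v k \<le> u k"
proof (cases up)
  case True
  have "Max ((\<lambda>u. u k) ` F) \<in> (\<lambda>u. u k) ` F"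
    using assms by (intro Max_in) auto
  then obtain v where "v \<in> F" "v k = Max ((\<lambda>u. u k) ` F)"
    by auto
  with True assms that[of v] show ?thesis by auto
next
  case False
  have "Min ((\<lambda>u. u k) ` F) \<in> (\<lambda>u. u k) ` F"
    using assms by (intro Min_in) auto
  then obtain v where "v \<in> F" "v k = Min ((\<lambda>u. u k) ` F)"
    by auto
  with False assms that[of v] show ?thesis by auto
qed

lemma step_ne_pos:
  assumes "step v (k, up) \<noteq> v"
  shows "up \<or> v k > 0"
proof (rule ccontr)
  assume "\<not> ?thesis"
  then have "step v (k, up) i = v i" for i
    by (simp add: step_def)
  with assms show False by blast
qed

text \<open>The common endpoint lies one unit beyond the extreme value \<open>v k\<close>. A step
  from \<open>u\<close> along another coordinate would leave \<open>u k\<close> beyond that value,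
  and so would the opposite step along \<open>k\<close>. Only the same signed step remains, and it
  can be undone.\<close>

lemma step_from_extreme:
  assumes "if up then u k \<le> v k else v k \<le> u k"
    and "step v (k, up) \<noteq> v"
    and "step v (k, up) = step u p"
  shows "u = v"
proof -
  obtain j up' where p: "p = (j, up')" by (cases p)
  have eq: "(v(k := if up then Suc (v k) else v k - 1)) i
      = (u(j := if up' then Suc (u j) else u j - 1)) i" for i
    using assms(3) by (simp add: step_def p)
  have pos: "up \<or> v k > 0"
    using assms(2) by (rule step_ne_pos)
  have j: "j = k"
    using eq[of k] assms(1) pos by (auto split: if_splits)
  have "u k = v k"
    using eq[of k] assms(1) pos j by (auto split: if_splits)
  moreover have "u i = v i" if "i \<noteq> k" for i
    using eq[of i] that j by simp
  ultimately show ?thesis by (metis (full_types) ext)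
qed

lemma full_degree_leaks:
  assumes H: "pair_graph H" and sub: "parcs H \<subseteq> parcs (grid_graph d n)"
    and F: "F \<subseteq> pverts H" "F \<noteq> {}"
    and deg: "\<And>v. v \<in> F \<Longrightarrow> 2 * d \<le> degree H v"
  shows "2 * d \<le> card {x \<in> pverts H - F. card (neighborhood H x \<inter> F) = 1}"
proof -
  interpret H: pair_graph H by fact
  let ?D = "{..<d} \<times> (UNIV :: bool set)"
  let ?L = "{x \<in> pverts H - F. card (neighborhood H x \<inter> F) = 1}"
  note nbh = full_degree(1)[OF sub deg] and inj = full_degree(2)[OF sub deg]
  have finF: "finite F"
    using F(1) H.pair_finite_verts by (rule finite_subset)
  have sym: "x \<in> neighborhood H u" if "u \<in> neighborhood H x" "x \<in> pverts H" for x u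
    using that H.arcs_symmetric by (auto simp: neighborhood_def)
  have irrefl: "u \<notin> neighborhood H u" for u
    using H.pair_no_loops[of "(u, u)"] by (auto simp: neighborhood_def)
  have "\<exists>v. v \<in> F \<and> step v p \<in> pverts H - F \<and> neighborhood H (step v p) \<inter> F = {v}"
    if "p \<in> ?D" for p
  proof -
    obtain k up where p: "p = (k, up)" by (cases p)
    obtain v where v: "v \<in> F" and ext: "\<And>u. u \<in> F \<Longrightarrow> if up then u k \<le> v k else v k \<le> u k"
      using extreme_vertex[OF finF F(2)] by blast
    have x: "step v p \<in> neighborhood H v"
      using nbh[OF v] that by blast
    \<comment> \<open>The absence of loops is what rules out a truncated step here: it would make
      \<open>v\<close> its own neighbour.\<close>
    then have xH: "step v p \<in> pverts H" and ne: "step v p \<noteq> v"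
      using irrefl by (auto simp: neighborhood_def)
    have "step v p \<notin> F"
    proof
      assume "step v p \<in> F"
      from ext[OF this] step_ne_pos[OF ne[unfolded p]] show False
        by (auto simp: p step_def split: if_splits)
    qed
    moreover have "v \<in> neighborhood H (step v p)"
      using v F(1) by (intro sym[OF x]) (rule subsetD)
    moreover have "u = v" if u: "u \<in> neighborhood H (step v p)" "u \<in> F" for u
    proof -
      have "step v p \<in> neighborhood H u"
        using u(1) xH by (rule sym)
      \<comment> \<open>The vertex \<open>u\<close> also lies in \<open>F\<close>, so its neighbours
        too are all of the form \<open>step u q\<close>.\<close>
      then obtain q where "step v p = step u q"
        using nbh[OF u(2)] by blast
      with ext[OF u(2)] ne show ?thesis
        unfolding p by (rule step_from_extreme)
    qed
    ultimately show ?thesis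
      using v xH by blast
  qed
  then obtain w where w: "\<And>p. p \<in> ?D \<Longrightarrow>
      w p \<in> F \<and> step (w p) p \<in> pverts H - F \<and> neighborhood H (step (w p) p) \<inter> F = {w p}"
    by metis
  have "inj_on (\<lambda>p. step (w p) p) ?D"
  proof (rule inj_onI)
    fix p q assume pq: "p \<in> ?D" "q \<in> ?D" and eq: "step (w p) p = step (w q) q"
    \<comment> \<open>Both \<open>{w p}\<close> and \<open>{w q}\<close> are the trace on
      \<open>F\<close> of the neighbourhood of the same leak. Full degree then makes
      \<open>step (w p)\<close> injective, which recovers the direction.\<close>
    then have "w p = w q"
      using w by (metis singleton_inject)
    with eq have "step (w p) p = step (w p) q"
      by simp
    moreover have "w p \<in> F"
      using w pq(1) by blast
    ultimately show "p = q"
      using inj_onD[OF inj _ pq] by blast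
  qed
  then have "card ((\<lambda>p. step (w p) p) ` ?D) = 2 * d"
    by (simp add: card_image card_cartesian_product)
  moreover have sub_L: "(\<lambda>p. step (w p) p) ` ?D \<subseteq> ?L"
  proof (rule image_subsetI)
    fix p assume "p \<in> ?D"
    from w[OF this] show "step (w p) p \<in> ?L" by simp
  qed
  moreover have "finite ?L"
    using H.pair_finite_verts by simp
  ultimately show ?thesis
    using card_mono[OF _ sub_L] by simp
qed

theorem theorem8:
  fixes d l :: nat and n :: "nat \<Rightarrow> nat"
    and H :: "(nat \<Rightarrow> nat) pair_pre_digraph" and F :: "(nat \<Rightarrow> nat) set"
  assumes "d \<ge> 1"
    and "\<And>k. k < d \<Longrightarrow> n k \<ge> 1"
    and "induced_subgraph (with_proj H) (with_proj (grid_graph d n))"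
    and "leaky_fort l H F"
    and "F \<noteq> {}"
    and "l \<le> 2 * d - 1"
  shows "(\<exists>v\<in>F. degree H v \<le> 2 * d - 1) \<and> F \<inter> boundary d H \<noteq> {}"
proof -
  have H: "pair_graph H"
    using pair_graph_grid_graph assms(3) by (rule pair_graph_induced_subgraph)
  have sub: "parcs H \<subseteq> parcs (grid_graph d n)"
    using assms(3) by (auto simp: induced_subgraph_def)
  have F: "F \<subseteq> pverts H"
    and leaks: "card {x \<in> pverts H - F. card (neighborhood H x \<inter> F) = 1} \<le> l"
    using assms(4) by (auto simp: leaky_fort_def)
  have "\<exists>v\<in>F. degree H v \<le> 2 * d - 1"
  proof (rule ccontr)
    assume "\<not> ?thesis"
    then have "2 * d \<le> degree H v" if "v \<in> F" for v
      using that by force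
    \<comment> \<open>As \<open>d \<ge> 1\<close>, the bound \<open>2 * d - 1\<close> on
      \<open>l\<close> is not truncated and lies strictly below the 2d leaks.\<close>
    from full_degree_leaks[OF H sub F assms(5) this] leaks assms(1,6) show False
      by linarith
  qed
  then show ?thesis
    using F by (auto simp: boundary_def)
qed

end
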